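(* Let $k \geq 2$ be an integer. If either Max moves first and $k$ is even, or Mini moves first and $k$ is odd, then $s(n, \mathcal{M}_k) \geq n-1$. In all other cases (Max moves first and $k$ is odd, or Mini moves first and $k$ is even), $s(n, \mathcal{M}_k) \leq \binom{2k-1}{2}$.
   Context: Let $\mathcal{P}$ be a monotone increasing property of graphs on vertex set $[n]$. An edge $e \in \binom{[n]}{2}\setminus E(G)$ is legal with respect to a graph $G \notin \mathcal{P}$ if $G \cup \{e\} \notin \mathcal{P}$. The saturation game $(n,\mathcal{P})$: starting from the empty graph on $[n]$, two players, Mini and Max, alternately add a legal edge to the current graph $G$. The game ends when no legal edge exists. Max wants to maximize the number of edges of the final graph and Mini wants to minimize it. The score $s(n,\mathcal{P})$ is the number of edges of the final graph under optimal play by both players; it may depend on which player moves first. $\mathcal{M}_k$ denotes the property of admitting a matching of size $k$. *)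

theory Defs
  imports Main "HOL-Library.Disjoint_Sets"
begin

text \<open>
  A graph on the vertex set \<open>[n] = {1..n}\<close> is identified with its edge set, a subset of
  \<open>pairs n\<close>; a graph property is a set of such edge sets.
\<close>

type_synonym graph = "nat set set"

definition pairs :: "nat \<Rightarrow> graph" where
  "pairs n = {e. e \<subseteq> {1..n} \<and> card e = 2}"

definition monotone_increasing :: "nat \<Rightarrow> graph set \<Rightarrow> bool" where
  "monotone_increasing n P \<longleftrightarrow>
     P \<subseteq> Pow (pairs n) \<and> (\<forall>G H. G \<in> P \<and> G \<subseteq> H \<and> H \<subseteq> pairs n \<longrightarrow> H \<in> P)"

definition legal_edges :: "nat \<Rightarrow> graph set \<Rightarrow> graph \<Rightarrow> graph" where
  "legal_edges n P G = {e \<in> pairs n - G. insert e G \<notin> P}"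

datatype player = Mini | Max

hide_const (open) Mini Max

fun opponent :: "player \<Rightarrow> player" where
  "opponent player.Mini = player.Max"
| "opponent player.Max = player.Mini"

lemma finite_pairs: "finite (pairs n)"
  unfolding pairs_def by (rule finite_subset[of _ "Pow {1..n}"]) auto

lemma card_pairs_diff_less:
  assumes "e \<in> legal_edges n P G"
  shows "card (pairs n - insert e G) < card (pairs n - G)"
  using assms finite_pairs[of n]
  by (intro psubset_card_mono) (auto simp: legal_edges_def)

text \<open>
  \<open>game_value n P p G\<close> is the number of edges of the final graph when both players play
  optimally from the position \<open>G\<close> with \<open>p\<close> to move (backward induction on the finite game tree).
\<close>

function game_value :: "nat \<Rightarrow> graph set \<Rightarrow> player \<Rightarrow> graph \<Rightarrow> nat" where
  "game_value n P p G =
     (if legal_edges n P G = {} then card G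
      else case p of
        player.Max \<Rightarrow>
          Lattices_Big.Max ((\<lambda>e. game_value n P (opponent p) (insert e G)) ` legal_edges n P G)
      | player.Mini \<Rightarrow>
          Min ((\<lambda>e. game_value n P (opponent p) (insert e G)) ` legal_edges n P G))"
  by pat_completeness auto
termination
  by (relation "measure (\<lambda>(n, P, p, G). card (pairs n - G))") (auto intro: card_pairs_diff_less)

declare game_value.simps [simp del]

text \<open>The second argument of \<open>score\<close> is the player who moves first.\<close>

definition score :: "nat \<Rightarrow> player \<Rightarrow> graph set \<Rightarrow> nat" where
  "score n p P = game_value n P p {}"

definition matching :: "graph \<Rightarrow> graph \<Rightarrow> bool" where
  "matching G M \<longleftrightarrow> M \<subseteq> G \<and> disjoint M"

definition matching_property :: "nat \<Rightarrow> nat \<Rightarrow> graph set" where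
  "matching_property n k = {G. G \<subseteq> pairs n \<and> (\<exists>M. matching G M \<and> card M = k)}"

lemma monotone_increasing_matching_property:
  "monotone_increasing n (matching_property n k)"
  unfolding monotone_increasing_def matching_property_def matching_def by blast

end

theory Submission
  imports Defs
begin

text \<open>
  For \<open>n < 2k\<close> the game ends with the complete graph. Otherwise the strategist keeps a partition of the
  vertices into blocks that contain all edges, odd blocks being factor-critical and even blocks having
  a perfect matching and being robust against the attachment of an odd block. The matching number is
  then the sum of \<open>\<lfloor>|B|/2\<rfloor>\<close> over the blocks. When the opponent joins an even block to another block, one
  further edge between the two repairs the structure; joining two odd blocks needs no repair.

  The favoured player leaves \<open>k - 1\<close> edges modulo 2 after each of her moves. If all blocks are complete,
  then the number of edges is congruent to the matching number, so when she is to move either a block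
  is incomplete or the matching number is below \<open>k - 1\<close>, and she has a move that keeps the structure.

  If Mini is favoured, the structure alone bounds the number of edges. If Max is favoured, he also has
  an even block whenever the matching number is \<open>k - 1\<close>. Mini eventually has to join some \<open>a\<close> in an even
  block to an odd block; Max then joins \<open>a\<close> to a second odd block, after which \<open>a\<close> lies in every maximum
  matching for good, so that in the end \<open>a\<close> is adjacent to all other vertices.
\<close>

section \<open>Strategies in saturation games\<close>

lemma finite_legal_edges: "finite (legal_edges n P G)"
  using finite_pairs[of n] by (simp add: legal_edges_def)

lemma game_value_Max_le_iff:
  assumes "legal_edges n P G \<noteq> {}"
  shows "game_value n P player.Max G \<le> m \<longleftrightarrow>
    (\<forall>e\<in>legal_edges n P G. game_value n P player.Mini (insert e G) \<le> m)"
  using assms finite_legal_edges[of n P G] by (subst game_value.simps) simp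

lemma game_value_Max_ge:
  assumes "e \<in> legal_edges n P G" "m \<le> game_value n P player.Mini (insert e G)"
  shows "m \<le> game_value n P player.Max G"
  using assms finite_legal_edges[of n P G]
  by (subst game_value.simps) (auto simp: Max_ge_iff)

lemma game_value_Mini_ge_iff:
  assumes "legal_edges n P G \<noteq> {}"
  shows "m \<le> game_value n P player.Mini G \<longleftrightarrow>
    (\<forall>e\<in>legal_edges n P G. m \<le> game_value n P player.Max (insert e G))"
  using assms finite_legal_edges[of n P G] by (subst game_value.simps) simp

lemma game_value_Mini_le:
  assumes "e \<in> legal_edges n P G" "game_value n P player.Max (insert e G) \<le> m"
  shows "game_value n P player.Mini G \<le> m"
  using assms finite_legal_edges[of n P G]
  by (subst game_value.simps) (auto simp: Min_le_iff)

lemma game_value_terminal: "legal_edges n P G = {} \<Longrightarrow> game_value n P p G = card G"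
  by (subst game_value.simps) simp

text \<open>A property kept by every legal edge holds at the end of every play, and the value is
  attained at some end. This serves positions from which choices no longer matter: pinned ones, and
  boards with \<open>n < 2 * k\<close>.\<close>

lemma game_value_invariant:
  assumes "Q G"
    and step: "\<And>G e. Q G \<Longrightarrow> e \<in> legal_edges n P G \<Longrightarrow> Q (insert e G)"
    and final: "\<And>G. Q G \<Longrightarrow> legal_edges n P G = {} \<Longrightarrow> R (card G)"
  shows "R (game_value n P p G)"
  using \<open>Q G\<close>
proof (induction "card (pairs n - G)" arbitrary: G p rule: less_induct)
  case less
  show ?case
  proof (cases "legal_edges n P G = {}")
    case True
    then show ?thesis using final less.prems by (simp add: game_value_terminal)
  next
    case False
    let ?V = "(\<lambda>e. game_value n P (opponent p) (insert e G)) ` legal_edges n P G"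
    have R: "R v" if "v \<in> ?V" for v
      using that less.hyps[OF card_pairs_diff_less step[OF less.prems]] by auto
    have fin: "finite ?V" "?V \<noteq> {}"
      using False finite_legal_edges by auto
    have "R (Min ?V)" "R (Lattices_Big.Max ?V)"
      using R[OF Min_in[OF fin]] R[OF Max_in[OF fin]] .
    then show ?thesis
      using False by (subst game_value.simps) (cases p; simp)
  qed
qed

text \<open>Induction over rounds of two moves: \<open>Q\<close> holds whenever Max is to move, in
  particular when the game stops with Max to move.\<close>

lemma Mini_strategy:
  assumes "Q G"
    and reply: "\<And>G e. Q G \<Longrightarrow> e \<in> legal_edges n P G \<Longrightarrow>
      \<exists>f\<in>legal_edges n P (insert e G). Q (insert f (insert e G))"
    and final: "\<And>G. Q G \<Longrightarrow> card G \<le> m"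
  shows "game_value n P player.Max G \<le> m"
  using \<open>Q G\<close>
proof (induction "card (pairs n - G)" arbitrary: G rule: less_induct)
  case less
  show ?case
  proof (cases "legal_edges n P G = {}")
    case True
    then show ?thesis using final less.prems by (simp add: game_value_terminal)
  next
    case False
    have "game_value n P player.Mini (insert e G) \<le> m" if e: "e \<in> legal_edges n P G" for e
    proof -
      obtain f where f: "f \<in> legal_edges n P (insert e G)" "Q (insert f (insert e G))"
        using reply less.prems e by blast
      have "card (pairs n - insert f (insert e G)) < card (pairs n - G)"
        using card_pairs_diff_less[OF e] card_pairs_diff_less[OF f(1)] by linarith
      then show ?thesis
        using less.hyps f game_value_Mini_le by blast
    qed
    then show ?thesis using False by (simp add: game_value_Max_le_iff)
  qed
qed

text \<open>\<open>Q\<close>-positions are never terminal and play is finite, so Max must at some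
  point leave \<open>Q\<close> through the second alternative, which already guarantees
  \<open>m\<close>.\<close>

lemma Max_strategy:
  assumes "Q G"
    and moves: "\<And>G. Q G \<Longrightarrow> legal_edges n P G \<noteq> {}"
    and reply: "\<And>G e. Q G \<Longrightarrow> e \<in> legal_edges n P G \<Longrightarrow>
      \<exists>f\<in>legal_edges n P (insert e G). Q (insert f (insert e G)) \<or>
        m \<le> game_value n P player.Mini (insert f (insert e G))"
  shows "m \<le> game_value n P player.Mini G"
  using \<open>Q G\<close>
proof (induction "card (pairs n - G)" arbitrary: G rule: less_induct)
  case less
  have "m \<le> game_value n P player.Max (insert e G)" if e: "e \<in> legal_edges n P G" for e
  proof -
    obtain f where f: "f \<in> legal_edges n P (insert e G)" "Q (insert f (insert e G)) \<or>
        m \<le> game_value n P player.Mini (insert f (insert e G))"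
      using reply less.prems e by blast
    have "card (pairs n - insert f (insert e G)) < card (pairs n - G)"
      using card_pairs_diff_less[OF e] card_pairs_diff_less[OF f(1)] by linarith
    then show ?thesis
      using less.hyps f game_value_Max_ge by blast
  qed
  then show ?case using moves less.prems by (simp add: game_value_Mini_ge_iff)
qed

section \<open>Matchings\<close>

lemma pairsD: "e \<in> pairs n \<Longrightarrow> card e = 2 \<and> finite e \<and> e \<subseteq> {1..n}"
  by (auto simp: pairs_def intro: finite_subset)

lemma doubleton_in_pairs: "{u, v} \<in> pairs n \<longleftrightarrow> u \<noteq> v \<and> u \<in> {1..n} \<and> v \<in> {1..n}"
  by (cases "u = v") (auto simp: pairs_def)

lemma card_pairs: "card (pairs n) = n choose 2"
  using n_subsets[of "{1..n}" 2] by (simp add: pairs_def)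

lemma card_Union_matching:
  assumes "disjoint M" "M \<subseteq> pairs n"
  shows "card (\<Union>M) = 2 * card M"
proof -
  have "card (\<Union>M) = sum card M"
    using assms pairsD by (intro card_Union_disjoint) blast+
  also have "\<dots> = sum (\<lambda>_. 2) M"
    using assms pairsD by (intro sum.cong) blast+
  finally show ?thesis by simp
qed

text \<open>Subsets of matchings are matchings, so "exactly \<open>k\<close> edges" may be read as
  "at least \<open>k\<close> edges".\<close>

lemma matching_property_iff:
  assumes "G \<subseteq> pairs n"
  shows "G \<in> matching_property n k \<longleftrightarrow> (\<exists>M\<subseteq>G. disjoint M \<and> k \<le> card M)"
proof
  assume "\<exists>M\<subseteq>G. disjoint M \<and> k \<le> card M"
  then obtain M where M: "M \<subseteq> G" "disjoint M" "k \<le> card M" by blast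
  obtain M' where "M' \<subseteq> M" "card M' = k"
    using M(3) by (metis obtain_subset_with_card_n)
  moreover from this M have "disjoint M'" by (blast intro: pairwise_subset)
  ultimately show "G \<in> matching_property n k"
    using M assms by (auto simp: matching_property_def matching_def)
qed (use assms in \<open>auto simp: matching_property_def matching_def\<close>)

lemma disjoint_insertI: "disjoint M \<Longrightarrow> e \<inter> \<Union>M = {} \<Longrightarrow> disjoint (insert e M)"
  by (auto simp: pairwise_insert disjnt_def)

lemma Union_Diff_singleton_disjoint:
  assumes "disjoint M" "e \<in> M"
  shows "\<Union>(M - {e}) = \<Union>M - e"
  using assms disjointD[OF assms(1)] by blast

lemma card_2_elemE:
  assumes "card e = 2" "a \<in> e"
  obtains b where "e = {a, b}" "a \<noteq> b"
  using assms by (auto simp: card_2_iff)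

text \<open>Follows the alternating path of \<open>M\<close> and \<open>N\<close> that starts in \<open>a\<close>.\<close>

lemma matching_exchange:
  assumes "finite M" "finite N" "card M = card N" "disjoint M" "disjoint N"
    and "\<forall>e\<in>M \<union> N. card e = 2" "a \<notin> \<Union>N"
    and "\<And>K. K \<subseteq> M \<union> N \<Longrightarrow> disjoint K \<Longrightarrow> card K \<le> card M"
  shows "\<exists>M' z. M' \<subseteq> M \<union> N \<and> disjoint M' \<and> card M' = card M \<and> a \<notin> \<Union>M' \<and> \<Union>M' \<subseteq> insert z (\<Union>M)"
  using assms
proof (induction "card M" arbitrary: M N a rule: less_induct)
  case less
  note fin = less.prems(1,2) and card_eq = less.prems(3) and dM = less.prems(4) and dN = less.prems(5)
    and two = less.prems(6) and aN = less.prems(7) and max = less.prems(8)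
  show ?case
  proof (cases "a \<in> \<Union>M")
    case False
    then show ?thesis using dM by (intro exI[of _ M]) auto
  next
    case True
    then obtain b where ab: "{a, b} \<in> M" "a \<noteq> b"
      using two card_2_elemE by (metis UnI1 UnionE)
    \<comment> \<open>Otherwise \<open>{a, b}\<close> could be added to \<open>N\<close>, against
      maximality.\<close>
    have "b \<in> \<Union>N"
    proof (rule ccontr)
      assume "b \<notin> \<Union>N"
      then have "disjoint (insert {a, b} N)" "{a, b} \<notin> N"
        using aN disjoint_insertI[OF dN, of "{a, b}"] by blast+
      then show False using max[of "insert {a, b} N"] ab fin card_eq by auto
    qed
    then obtain c where bc: "{b, c} \<in> N" "b \<noteq> c"
      using two card_2_elemE by (metis UnI2 UnionE)
    have ca: "c \<noteq> a" using bc aN by blast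
    define M0 N0 where "M0 = M - {{a, b}}" and "N0 = N - {{b, c}}"
    have M0: "a \<notin> \<Union>M0" "b \<notin> \<Union>M0"
      unfolding M0_def Union_Diff_singleton_disjoint[OF dM ab(1)] by auto
    have N0: "b \<notin> \<Union>N0" "c \<notin> \<Union>N0" "a \<notin> \<Union>N0"
      using aN unfolding N0_def Union_Diff_singleton_disjoint[OF dN bc(1)] by auto
    have cards: "card M = Suc (card M0)" "card N = Suc (card N0)"
      using card_Suc_Diff1[OF fin(1) ab(1)] card_Suc_Diff1[OF fin(2) bc(1)] by (simp_all add: M0_def N0_def)
    have disj: "disjoint M0" "disjoint N0"
      using pairwise_subset[OF dM, of M0] pairwise_subset[OF dN, of N0] by (auto simp: M0_def N0_def)
    \<comment> \<open>The path ends in \<open>c\<close>: replacing \<open>{a, b}\<close> by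
      \<open>{b, c}\<close> frees \<open>a\<close> and covers \<open>c\<close>, which becomes
      \<open>z\<close>.\<close>
    have ?thesis if cM: "c \<notin> \<Union>M"
    proof -
      have "disjoint (insert {b, c} M0)" "{b, c} \<notin> M0"
        using cM M0 disjoint_insertI[OF disj(1), of "{b, c}"] unfolding M0_def by blast+
      moreover have "finite M0" using fin by (simp add: M0_def)
      moreover have "insert {b, c} M0 \<subseteq> M \<union> N" "a \<notin> \<Union>(insert {b, c} M0)"
          "\<Union>(insert {b, c} M0) \<subseteq> insert c (\<Union>M)"
        using ab bc ca M0 by (auto simp: M0_def)
      ultimately show ?thesis using cards by (intro exI[of _ "insert {b, c} M0"] exI[of _ c]) simp
    qed
    moreover have ?thesis if cM: "c \<in> \<Union>M"
    proof -
      \<comment> \<open>The path goes on from \<open>c\<close>, which \<open>N0\<close> misses.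
        Maximality passes to \<open>M0\<close> and \<open>N0\<close> because \<open>{a, b}\<close>
        can be added to any matching in their union.\<close>
      have "card K \<le> card M0" if K: "K \<subseteq> M0 \<union> N0" "disjoint K" for K
      proof -
        have "finite K" using K fin by (auto simp: M0_def N0_def intro: finite_subset)
        moreover have ab_out: "a \<notin> \<Union>K" "b \<notin> \<Union>K" using K M0 N0 by blast+
        then have "disjoint (insert {a, b} K)" "{a, b} \<notin> K"
          using disjoint_insertI[OF K(2), of "{a, b}"] by blast+
        moreover have "insert {a, b} K \<subseteq> M \<union> N" using K ab by (auto simp: M0_def N0_def)
        ultimately show ?thesis using max[of "insert {a, b} K"] cards by simp
      qed
      moreover have "\<forall>e\<in>M0 \<union> N0. card e = 2" "finite M0" "finite N0"
        using two fin by (auto simp: M0_def N0_def)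
      ultimately obtain M' z where M': "M' \<subseteq> M0 \<union> N0" "disjoint M'" "card M' = card M0"
          "c \<notin> \<Union>M'" "\<Union>M' \<subseteq> insert z (\<Union>M0)"
        using less.hyps[of M0 N0 c] cards card_eq disj N0(2) by auto
      have "a \<notin> \<Union>M'" "b \<notin> \<Union>M'" using M' M0 N0 by blast+
      then have new: "disjoint (insert {b, c} M')" "{b, c} \<notin> M'" "a \<notin> \<Union>(insert {b, c} M')"
        using M' ab ca disjoint_insertI[OF M'(2), of "{b, c}"] by blast+
      have "finite M'" using M' fin by (auto simp: M0_def N0_def intro: finite_subset)
      then have card': "card (insert {b, c} M') = card M" using new M' cards by simp
      have sub: "insert {b, c} M' \<subseteq> M \<union> N" using M' bc by (auto simp: M0_def N0_def)
      have "\<Union>(insert {b, c} M') \<subseteq> insert z (\<Union>M)"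
        using M' ab cM by (auto simp: M0_def)
      then show ?thesis using new card' sub by blast
    qed
    ultimately show ?thesis by blast
  qed
qed

section \<open>Factor-critical and extendable blocks\<close>

definition perfectly_matched :: "graph \<Rightarrow> nat set \<Rightarrow> bool" where
  "perfectly_matched G S \<longleftrightarrow> (\<exists>M\<subseteq>G. disjoint M \<and> \<Union>M = S)"

definition factor_critical :: "graph \<Rightarrow> nat set \<Rightarrow> bool" where
  "factor_critical G B \<longleftrightarrow> (\<forall>y\<in>B. perfectly_matched G (B - {y}))"

text \<open>
  Joining a new vertex \<open>x\<close> to \<open>a\<close> and \<open>b\<close> makes \<open>B \<union> {x}\<close> factor-critical, provided that \<open>B\<close> has a perfect
  matching; \<open>x\<close> itself is eliminated, as after deleting \<open>y\<close> it has to be matched to \<open>a\<close> or to \<open>b\<close>.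
\<close>

definition completes :: "graph \<Rightarrow> nat set \<Rightarrow> nat \<Rightarrow> nat \<Rightarrow> bool" where
  "completes G B a b \<longleftrightarrow> a \<in> B \<and> b \<in> B \<and>
     (\<forall>y\<in>B. y \<noteq> a \<and> perfectly_matched G (B - {a, y}) \<or> y \<noteq> b \<and> perfectly_matched G (B - {b, y}))"

definition extendable :: "graph \<Rightarrow> nat set \<Rightarrow> bool" where
  "extendable G B \<longleftrightarrow> perfectly_matched G B \<and> (\<forall>a\<in>B. \<exists>b. completes G B a b)"

section \<open>Monotonicity, unions and joins of blocks\<close>

lemma perfectly_matched_mono: "perfectly_matched G S \<Longrightarrow> G \<subseteq> H \<Longrightarrow> perfectly_matched H S"
  unfolding perfectly_matched_def by blast

lemma perfectly_matched_empty [simp]: "perfectly_matched G {}"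
  unfolding perfectly_matched_def by (intro exI[of _ "{}"]) auto

lemma perfectly_matched_edge: "e \<in> G \<Longrightarrow> perfectly_matched G e"
  unfolding perfectly_matched_def by (intro exI[of _ "{e}"]) auto

lemma perfectly_matched_Un:
  assumes "perfectly_matched G S" "perfectly_matched G T" "S \<inter> T = {}"
  shows "perfectly_matched G (S \<union> T)"
proof -
  obtain M N where "M \<subseteq> G" "disjoint M" "\<Union>M = S" "N \<subseteq> G" "disjoint N" "\<Union>N = T"
    using assms unfolding perfectly_matched_def by auto
  then show ?thesis
    using assms(3) disjoint_union[of M N] unfolding perfectly_matched_def
    by (intro exI[of _ "M \<union> N"]) auto
qed

lemma perfectly_matched_UN:
  assumes "finite I" "\<And>i. i \<in> I \<Longrightarrow> perfectly_matched G (S i)" "disjoint_family_on S I"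
  shows "perfectly_matched G (\<Union>i\<in>I. S i)"
  using assms
proof (induction I)
  case (insert i I)
  have "S i \<inter> (\<Union>j\<in>I. S j) = {}"
    using insert.prems(2) insert.hyps(2) by (auto simp: disjoint_family_on_def)
  moreover have "disjoint_family_on S I"
    using insert.prems(2) by (auto simp: disjoint_family_on_def)
  ultimately show ?case
    using insert perfectly_matched_Un[of G "S i" "\<Union>j\<in>I. S j"] by simp
qed simp

lemma factor_critical_mono: "factor_critical G B \<Longrightarrow> G \<subseteq> H \<Longrightarrow> factor_critical H B"
  unfolding factor_critical_def using perfectly_matched_mono by blast

lemma completes_mono: "completes G B a b \<Longrightarrow> G \<subseteq> H \<Longrightarrow> completes H B a b"
  unfolding completes_def using perfectly_matched_mono by blast

lemma extendable_mono: "extendable G B \<Longrightarrow> G \<subseteq> H \<Longrightarrow> extendable H B"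
  unfolding extendable_def using perfectly_matched_mono completes_mono by blast

lemma completes_neq: "completes G B a b \<Longrightarrow> a \<noteq> b"
  unfolding completes_def by blast

lemma factor_critical_singleton: "factor_critical G {v}"
  unfolding factor_critical_def by simp

text \<open>For \<open>y\<close> in \<open>A\<close> delete \<open>b\<close>, for \<open>y\<close>
  in \<open>B\<close> delete \<open>a\<close>: each block then loses exactly one vertex, and both
  remainders have perfect matchings.\<close>

lemma completes_join_factor_critical:
  assumes A: "factor_critical G A" and B: "factor_critical G B"
    and dj: "A \<inter> B = {}" and "a \<in> A" "b \<in> B"
  shows "completes G (A \<union> B) a b"
  unfolding completes_def
proof (intro conjI ballI)
  fix y assume y: "y \<in> A \<union> B"
  show "y \<noteq> a \<and> perfectly_matched G (A \<union> B - {a, y}) \<or> y \<noteq> b \<and> perfectly_matched G (A \<union> B - {b, y})"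
  proof (cases "y \<in> A")
    case True
    have "A \<union> B - {b, y} = (A - {y}) \<union> (B - {b})" "(A - {y}) \<inter> (B - {b}) = {}"
      using True dj assms by auto
    then have "perfectly_matched G (A \<union> B - {b, y})"
      using True A B assms perfectly_matched_Un unfolding factor_critical_def by metis
    then show ?thesis using True dj assms by blast
  next
    case False
    then have "y \<in> B" using y by simp
    have "A \<union> B - {a, y} = (A - {a}) \<union> (B - {y})" "(A - {a}) \<inter> (B - {y}) = {}"
      using False dj assms by auto
    then have "perfectly_matched G (A \<union> B - {a, y})"
      using \<open>y \<in> B\<close> A B assms perfectly_matched_Un unfolding factor_critical_def by metis
    then show ?thesis using False assms by blast
  qed
qed (use assms in auto)

lemma completes_sym: "completes G B a b \<Longrightarrow> completes G B b a"
  unfolding completes_def by blast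

text \<open>The edge \<open>{u, v}\<close> matches the two vertices left over by near-perfect
  matchings. Any vertex of \<open>A\<close> and any of \<open>B\<close> form a completing pair, so
  \<open>v\<close> is a partner for all of \<open>A\<close> and \<open>u\<close> for all of
  \<open>B\<close>.\<close>

lemma extendable_join_factor_critical:
  assumes A: "factor_critical G A" and B: "factor_critical G B"
    and dj: "A \<inter> B = {}" and uv: "u \<in> A" "v \<in> B" "{u, v} \<in> G"
  shows "extendable G (A \<union> B)"
  unfolding extendable_def
proof
  have "perfectly_matched G ((A - {u}) \<union> (B - {v}) \<union> {u, v})"
    using A B uv dj unfolding factor_critical_def
    by (intro perfectly_matched_Un) (auto simp: perfectly_matched_edge)
  moreover have "(A - {u}) \<union> (B - {v}) \<union> {u, v} = A \<union> B" using uv by auto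
  ultimately show "perfectly_matched G (A \<union> B)" by simp
  have "completes G (A \<union> B) a v" if "a \<in> A" for a
    using completes_join_factor_critical A B dj that uv by blast
  moreover have "completes G (A \<union> B) a u" if "a \<in> B" for a
    using completes_join_factor_critical[OF A B dj uv(1) that] by (rule completes_sym)
  ultimately show "\<forall>a\<in>A \<union> B. \<exists>b. completes G (A \<union> B) a b" by blast
qed

text \<open>If \<open>y\<close> lies in \<open>A\<close>, then \<open>B\<close> is matched by
  itself. If \<open>y\<close> lies in \<open>B\<close>, deleting \<open>y\<close> and one of
  \<open>a\<close>, \<open>b\<close> leaves both sides odd, and one of the two cross edges balances
  them.\<close>

lemma completes_join_extendable:
  assumes A: "perfectly_matched G A" "completes G A a b" "completes G A u u'"
    and B: "perfectly_matched G B" "completes G B v v'"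
    and dj: "A \<inter> B = {}" and edges: "{u, v} \<in> G" "{u', v'} \<in> G"
  shows "completes G (A \<union> B) a b"
  unfolding completes_def
proof (intro conjI ballI)
  fix y assume y: "y \<in> A \<union> B"
  show "y \<noteq> a \<and> perfectly_matched G (A \<union> B - {a, y}) \<or> y \<noteq> b \<and> perfectly_matched G (A \<union> B - {b, y})"
  proof (cases "y \<in> A")
    case True
    have "perfectly_matched G (A \<union> B - {c, y})" if "c \<in> A" "perfectly_matched G (A - {c, y})" for c
    proof -
      have "A \<union> B - {c, y} = (A - {c, y}) \<union> B" "(A - {c, y}) \<inter> B = {}"
        using True that dj by auto
      then show ?thesis using perfectly_matched_Un that B by metis
    qed
    then show ?thesis using True A(2) unfolding completes_def by blast
  next
    case False
    then have yB: "y \<in> B" using y by simp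
    have aA: "a \<in> A" "b \<in> A" using A unfolding completes_def by auto
    have *: "perfectly_matched G (A \<union> B - {c, y})"
      if "c \<in> A" "p \<in> A" "q \<in> B" "c \<noteq> p" "y \<noteq> q" "{p, q} \<in> G"
        "perfectly_matched G (A - {c, p})" "perfectly_matched G (B - {q, y})" for c p q
    proof -
      have "perfectly_matched G ((A - {c, p}) \<union> (B - {q, y}) \<union> {p, q})"
        using that dj by (intro perfectly_matched_Un) (auto simp: perfectly_matched_edge)
      moreover have "(A - {c, p}) \<union> (B - {q, y}) \<union> {p, q} = A \<union> B - {c, y}"
        using that yB dj by auto
      ultimately show ?thesis by simp
    qed
    \<comment> \<open>The pair \<open>v\<close>, \<open>v'\<close> selects the cross edge whose end
      \<open>q\<close> can be deleted from \<open>B\<close> along with \<open>y\<close>; its other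
      end \<open>p\<close> then plays the role of the deleted vertex for the pair \<open>a\<close>,
      \<open>b\<close>.\<close>
    have "\<exists>p\<in>A. \<exists>q\<in>B. {p, q} \<in> G \<and> y \<noteq> q \<and> perfectly_matched G (B - {q, y})"
      using A(3) B(2) yB edges unfolding completes_def by blast
    then obtain p q where pq: "p \<in> A" "q \<in> B" "{p, q} \<in> G" "y \<noteq> q" "perfectly_matched G (B - {q, y})"
      by blast
    then have "p \<noteq> a \<and> perfectly_matched G (A - {a, p}) \<or> p \<noteq> b \<and> perfectly_matched G (A - {b, p})"
      using A(2) unfolding completes_def by blast
    then show ?thesis
      using *[OF aA(1) pq(1,2) _ pq(4,3) _ pq(5)] *[OF aA(2) pq(1,2) _ pq(4,3) _ pq(5)] aA dj yB by blast
  qed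
qed (use A in \<open>auto simp: completes_def\<close>)

lemma extendable_join_extendable:
  assumes A: "extendable G A" "completes G A u u'"
    and B: "extendable G B" "completes G B v v'"
    and dj: "A \<inter> B = {}" and edges: "{u, v} \<in> G" "{u', v'} \<in> G"
  shows "extendable G (A \<union> B)"
  unfolding extendable_def
proof
  have pm: "perfectly_matched G A" "perfectly_matched G B"
    using A B unfolding extendable_def by auto
  then show "perfectly_matched G (A \<union> B)" using dj perfectly_matched_Un by blast
  have edges': "{v, u} \<in> G" "{v', u'} \<in> G" "B \<inter> A = {}" using edges dj by (auto simp: insert_commute)
  have "\<exists>b. completes G (A \<union> B) a b" if "a \<in> A" for a
    using A(1) that completes_join_extendable[OF pm(1) _ A(2) pm(2) B(2) dj edges]
    unfolding extendable_def by blast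
  moreover have "\<exists>b. completes G (A \<union> B) a b" if "a \<in> B" for a
    using B(1) that completes_join_extendable[OF pm(2) _ B(2) pm(1) A(2) edges'(3,1,2)]
    unfolding extendable_def Un_commute[of B A] by blast
  ultimately show "\<forall>a\<in>A \<union> B. \<exists>b. completes G (A \<union> B) a b" by blast
qed

text \<open>For \<open>y\<close> in \<open>B\<close>, one of \<open>a\<close>, \<open>b\<close> can
  be deleted from \<open>B\<close> together with \<open>y\<close>, and it is matched to
  \<open>x\<close>, the vertex left over in \<open>A\<close>.\<close>

lemma factor_critical_join_extendable:
  assumes A: "factor_critical G A" and B: "extendable G B" "completes G B a b"
    and dj: "A \<inter> B = {}" and x: "x \<in> A" "{x, a} \<in> G" "{x, b} \<in> G"
  shows "factor_critical G (A \<union> B)"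
  unfolding factor_critical_def
proof
  fix y assume y: "y \<in> A \<union> B"
  show "perfectly_matched G (A \<union> B - {y})"
  proof (cases "y \<in> A")
    case True
    then have "A \<union> B - {y} = (A - {y}) \<union> B" "(A - {y}) \<inter> B = {}" using dj by auto
    then show ?thesis
      using True A B perfectly_matched_Un unfolding factor_critical_def extendable_def by metis
  next
    case False
    then have yB: "y \<in> B" using y by simp
    then obtain c where c: "c \<in> B" "y \<noteq> c" "perfectly_matched G (B - {c, y})" "{x, c} \<in> G"
      using B(2) x unfolding completes_def by blast
    have "perfectly_matched G ((A - {x}) \<union> (B - {c, y}) \<union> {x, c})"
      using A c x dj unfolding factor_critical_def
      by (intro perfectly_matched_Un) (auto simp: perfectly_matched_edge)
    moreover have "(A - {x}) \<union> (B - {c, y}) \<union> {x, c} = A \<union> B - {y}"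
      using x c dj yB by auto
    ultimately show ?thesis by simp
  qed
qed

section \<open>Partitions into blocks\<close>

definition inside :: "nat set set \<Rightarrow> graph \<Rightarrow> bool" where
  "inside P G \<longleftrightarrow> (\<forall>e\<in>G. \<exists>B\<in>P. e \<subseteq> B)"

definition block_matching :: "nat set set \<Rightarrow> nat" where
  "block_matching P = (\<Sum>B\<in>P. card B div 2)"

definition merge :: "nat set set \<Rightarrow> nat set \<Rightarrow> nat set \<Rightarrow> nat set set" where
  "merge P A B = insert (A \<union> B) (P - {A, B})"

lemma finite_partition_atLeastAtMost: "partition_on {1..n::nat} P \<Longrightarrow> finite P"
  using finite_elements by blast

lemma finite_block: "partition_on {1..n::nat} P \<Longrightarrow> B \<in> P \<Longrightarrow> finite B"
  by (metis Union_upper finite_atLeastAtMost finite_subset partition_onD1)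

lemma block_disjoint: "partition_on V P \<Longrightarrow> A \<in> P \<Longrightarrow> B \<in> P \<Longrightarrow> A \<noteq> B \<Longrightarrow> A \<inter> B = {}"
  using disjointD partition_onD2 by metis

lemma block_unique:
  assumes "partition_on V P" "A \<in> P" "B \<in> P" "v \<in> A" "v \<in> B"
  shows "A = B"
  using block_disjoint[OF assms(1-3)] assms(4,5) by blast

lemma partition_on_merge:
  assumes P: "partition_on V P" and "A \<in> P" "B \<in> P"
  shows "partition_on V (merge P A B)"
proof (rule partition_onI)
  show "\<Union>(merge P A B) = V"
    using partition_onD1[OF P] assms(2,3) by (auto simp: merge_def)
  show "disjnt p q" if "p \<in> merge P A B" "q \<in> merge P A B" "p \<noteq> q" for p q
  proof -
    have "disjnt (A \<union> B) r" if "r \<in> P - {A, B}" for r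
      using that block_disjoint[OF P, of A r] block_disjoint[OF P, of B r] assms(2,3)
      by (auto simp: disjnt_def)
    then show ?thesis
      using that block_disjoint[OF P, of p q] disjnt_sym by (auto simp: merge_def disjnt_def)
  qed
  show "{} \<notin> merge P A B"
    using partition_onD3[OF P] assms(2) by (auto simp: merge_def)
qed

lemma sum_Diff_doubleton:
  fixes f :: "'a \<Rightarrow> nat"
  assumes "finite P" "A \<in> P" "B \<in> P" "A \<noteq> B"
  shows "sum f P = f A + f B + sum f (P - {A, B})"
proof -
  have "P = {A, B} \<union> (P - {A, B})" using assms by auto
  then have "sum f P = sum f {A, B} + sum f (P - {A, B})"
    using assms(1) by (metis Diff_disjoint finite_Diff finite_Un sum.union_disjoint)
  then show ?thesis using assms(4) by simp
qed

lemma block_matching_merge: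
  assumes P: "partition_on {1..n::nat} P" and AB: "A \<in> P" "B \<in> P" "A \<noteq> B"
  shows "block_matching (merge P A B) =
    block_matching P + (if odd (card A) \<and> odd (card B) then 1 else 0)"
proof -
  have fin: "finite P" "finite A" "finite B"
    using finite_partition_atLeastAtMost finite_block P AB by blast+
  have dj: "A \<inter> B = {}" using block_disjoint P AB by blast
  have "A \<noteq> {}" using partition_onD3[OF P] AB by blast
  \<comment> \<open>Otherwise the sum over the set \<open>merge P A B\<close> would not count the
    union as a new block.\<close>
  have "A \<union> B \<notin> P - {A, B}"
  proof
    assume "A \<union> B \<in> P - {A, B}"
    then have "(A \<union> B) \<inter> A = {}" using block_disjoint[OF P, of "A \<union> B" A] AB by blast
    then show False using \<open>A \<noteq> {}\<close> by blast
  qed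
  then have "block_matching (merge P A B) = (card A + card B) div 2 + (\<Sum>B\<in>P - {A, B}. card B div 2)"
    using fin dj by (simp add: block_matching_def merge_def card_Un_disjoint)
  moreover have "block_matching P = card A div 2 + card B div 2 + (\<Sum>B\<in>P - {A, B}. card B div 2)"
    unfolding block_matching_def by (rule sum_Diff_doubleton[OF fin(1) AB])
  moreover have "(card A + card B) div 2 =
      card A div 2 + card B div 2 + (if odd (card A) \<and> odd (card B) then 1 else 0)"
    by (auto elim!: evenE oddE)
  ultimately show ?thesis by simp
qed

text \<open>Every edge of \<open>M\<close> lies in a block, and the edges of \<open>M\<close> inside
  \<open>B\<close> cover twice their number of vertices of \<open>B\<close>.\<close>

lemma card_matching_le_block_matching:
  assumes P: "partition_on {1..n} P" and M: "M \<subseteq> pairs n" "inside P M" "disjoint M"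
  shows "card M \<le> block_matching P"
proof -
  have finP: "finite P" using finite_partition_atLeastAtMost P .
  have "M = (\<Union>B\<in>P. {e\<in>M. e \<subseteq> B})" using M(2) by (auto simp: inside_def)
  then have "card M \<le> (\<Sum>B\<in>P. card {e\<in>M. e \<subseteq> B})"
    using card_UN_le[OF finP, of "\<lambda>B. {e\<in>M. e \<subseteq> B}"] by simp
  also have "\<dots> \<le> (\<Sum>B\<in>P. card B div 2)"
  proof (rule sum_mono)
    fix B assume "B \<in> P"
    have "2 * card {e\<in>M. e \<subseteq> B} = card (\<Union>{e\<in>M. e \<subseteq> B})"
      using M pairwise_subset[OF M(3), of "{e\<in>M. e \<subseteq> B}"]
      by (intro card_Union_matching[symmetric, of _ n]) auto
    also have "\<dots> \<le> card B"
      using finite_block[OF P \<open>B \<in> P\<close>] by (intro card_mono) auto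
    finally show "card {e\<in>M. e \<subseteq> B} \<le> card B div 2" by simp
  qed
  finally show ?thesis by (simp add: block_matching_def)
qed

lemma not_matching_property_if_inside:
  assumes "partition_on {1..n} P" "G \<subseteq> pairs n" "inside P G" "block_matching P < k"
  shows "G \<notin> matching_property n k"
proof
  assume "G \<in> matching_property n k"
  then obtain M where M: "M \<subseteq> G" "disjoint M" "k \<le> card M"
    using matching_property_iff assms(2) by blast
  then have "card M \<le> block_matching P"
    using card_matching_le_block_matching[OF assms(1), of M] assms(2,3) by (auto simp: inside_def)
  then show False using M(3) assms(4) by simp
qed

section \<open>Edge and vertex counts of a partition\<close>

definition block_pairs :: "nat set set \<Rightarrow> graph" where
  "block_pairs P = (\<Union>B\<in>P. {e. e \<subseteq> B \<and> card e = 2})"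

lemma card_block_pairs:
  assumes P: "partition_on {1..n::nat} P"
  shows "card (block_pairs P) = (\<Sum>B\<in>P. card B choose 2)"
proof -
  have fin: "finite P" "\<And>B. B \<in> P \<Longrightarrow> finite B"
    using finite_partition_atLeastAtMost[OF P] finite_block[OF P] by auto
  have "card (block_pairs P) = (\<Sum>B\<in>P. card {e. e \<subseteq> B \<and> card e = 2})"
    unfolding block_pairs_def
  proof (rule card_UN_disjoint[OF fin(1)]; intro ballI impI)
    fix A B assume AB: "A \<in> P" "B \<in> P" "A \<noteq> B"
    then have "A \<inter> B = {}" using block_disjoint[OF P] by blast
    then have "card e \<noteq> 2" if "e \<subseteq> A" "e \<subseteq> B" for e
      using that by (metis Int_greatest card.empty subset_empty zero_neq_numeral)
    then show "{e. e \<subseteq> A \<and> card e = 2} \<inter> {e. e \<subseteq> B \<and> card e = 2} = {}" by blast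
  qed (use fin in simp)
  also have "\<dots> = (\<Sum>B\<in>P. card B choose 2)"
    using fin(2) n_subsets by (intro sum.cong) auto
  finally show ?thesis .
qed

text \<open>For \<open>m = 2 * b\<close> the coefficient is \<open>b * (2 * b - 1)\<close>, for
  \<open>m = 2 * b + 1\<close> it is \<open>b * (2 * b + 1)\<close>; both have the parity of
  \<open>b\<close> (trivially if \<open>b = 0\<close>).\<close>

lemma even_choose_2: "even (m choose 2) \<longleftrightarrow> even (m div 2)"
proof (cases "even m")
  case True
  then obtain b where "m = 2 * b" by blast
  then show ?thesis by (cases b) (simp_all add: choose_two)
next
  case False
  then obtain b where "m = 2 * b + 1" by (blast elim: oddE)
  then show ?thesis by (simp add: choose_two)
qed

lemma even_card_block_pairs:
  assumes "partition_on {1..n::nat} P"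
  shows "even (card (block_pairs P)) \<longleftrightarrow> even (block_matching P)"
proof -
  have "finite P" using finite_partition_atLeastAtMost assms .
  then have "even (\<Sum>B\<in>P. card B choose 2) \<longleftrightarrow> even (\<Sum>B\<in>P. card B div 2)"
    by (induction P) (auto simp: even_choose_2)
  then show ?thesis using assms by (simp add: card_block_pairs block_matching_def)
qed

text \<open>With \<open>b\<close> half the block size rounded down and \<open>m\<close> the sum of
  all \<open>b\<close>, a block has at most \<open>b * (2 * b + 1) \<le> b * (2 * m + 1)\<close>
  pairs. For \<open>m = k - 1\<close> the total is the bound of the theorem.\<close>

lemma card_block_pairs_le:
  assumes "partition_on {1..n::nat} P"
  shows "card (block_pairs P) \<le> (2 * block_matching P + 1) choose 2"
proof -
  have fin: "finite P" using finite_partition_atLeastAtMost assms .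
  let ?m = "block_matching P"
  have "card (block_pairs P) \<le> (\<Sum>B\<in>P. card B div 2 * (2 * ?m + 1))"
    unfolding card_block_pairs[OF assms]
  proof (rule sum_mono)
    fix B assume "B \<in> P"
    let ?b = "card B div 2"
    have "card B choose 2 \<le> (2 * ?b + 1) choose 2" by (rule binomial_right_mono) simp
    also have "\<dots> = ?b * (2 * ?b + 1)" by (simp add: choose_two)
    also have "?b \<le> ?m"
      unfolding block_matching_def using fin \<open>B \<in> P\<close> by (intro member_le_sum) auto
    then have "?b * (2 * ?b + 1) \<le> ?b * (2 * ?m + 1)" by simp
    finally show "card B choose 2 \<le> ?b * (2 * ?m + 1)" .
  qed
  also have "\<dots> = ?m * (2 * ?m + 1)"
    by (simp only: block_matching_def sum_distrib_right)
  also have "\<dots> = (2 * ?m + 1) choose 2" by (simp add: choose_two)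
  finally show ?thesis .
qed

text \<open>Pairing up the vertices inside each block leaves one vertex over in each odd
  block.\<close>

lemma card_odd_blocks:
  assumes P: "partition_on {1..n::nat} P"
  shows "n = 2 * block_matching P + card {B\<in>P. odd (card B)}"
proof -
  have fin: "finite P" using finite_partition_atLeastAtMost P .
  have "n = card (\<Union>P)" using partition_onD1[OF P, symmetric] by simp
  also have "\<dots> = sum card P"
    using partition_onD2[OF P] finite_block[OF P] by (intro card_Union_disjoint) auto
  also have "\<dots> = (\<Sum>B\<in>P. 2 * (card B div 2) + card B mod 2)" by simp
  also have "\<dots> = 2 * block_matching P + (\<Sum>B\<in>P. card B mod 2)"
    by (simp only: sum.distrib sum_distrib_left block_matching_def)
  also have "(\<Sum>B\<in>P. card B mod 2) = (\<Sum>B\<in>P. if odd (card B) then 1 else 0)"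
    by (intro sum.cong) (auto simp: odd_iff_mod_2_eq_one)
  also have "\<dots> = card {B\<in>P. odd (card B)}"
    using fin by (simp add: sum.If_cases Int_def)
  finally show ?thesis .
qed

lemma obtain_odd_blocks:
  assumes "partition_on {1..n::nat} P" "2 * block_matching P + 2 \<le> n"
  obtains A B where "A \<in> P" "B \<in> P" "A \<noteq> B" "odd (card A)" "odd (card B)"
proof -
  have "2 \<le> card {B\<in>P. odd (card B)}" using card_odd_blocks assms by fastforce
  from obtain_subset_with_card_n[OF this]
  obtain S where "S \<subseteq> {B\<in>P. odd (card B)}" "card S = 2" by blast
  then show thesis using that by (auto simp: card_2_iff)
qed

section \<open>Structured positions\<close>

definition sound_block :: "graph \<Rightarrow> nat set \<Rightarrow> bool" where
  "sound_block G B \<longleftrightarrow> (if even (card B) then extendable G B else factor_critical G B)"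

definition structured :: "nat \<Rightarrow> graph \<Rightarrow> nat set set \<Rightarrow> bool" where
  "structured n G P \<longleftrightarrow> G \<subseteq> pairs n \<and> partition_on {1..n} P \<and> inside P G \<and> (\<forall>B\<in>P. sound_block G B)"

lemma structuredD:
  assumes "structured n G P"
  shows "G \<subseteq> pairs n" "partition_on {1..n} P" "inside P G" "B \<in> P \<Longrightarrow> sound_block G B"
  using assms by (auto simp: structured_def)

lemma sound_block_mono: "sound_block G B \<Longrightarrow> G \<subseteq> H \<Longrightarrow> sound_block H B"
  using extendable_mono[of G B H] factor_critical_mono[of G B H] by (simp add: sound_block_def split: if_splits)

lemma structured_empty: "structured n {} ((\<lambda>v. {v}) ` {1..n})"
  by (auto simp: structured_def inside_def sound_block_def partition_on_singletons factor_critical_singleton)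

lemma block_matching_singletons: "block_matching ((\<lambda>v. {v}) ` V) = 0"
  unfolding block_matching_def by (intro sum.neutral) auto

text \<open>\<open>c\<close> prescribes the vertex left exposed in each odd block. The pinning reply
  uses this freedom to expose two chosen vertices.\<close>

lemma structured_matching:
  assumes G: "structured n G P" and c: "\<And>B. B \<in> P \<Longrightarrow> c B \<in> B"
  shows "\<exists>M\<subseteq>G. disjoint M \<and> card M = block_matching P \<and> (\<forall>B\<in>P. odd (card B) \<longrightarrow> c B \<notin> \<Union>M)"
proof -
  note P = structuredD(2)[OF G]
  define core where "core B = (if even (card B) then B else B - {c B})" for B
  have core_sub: "core B \<subseteq> B" for B by (auto simp: core_def)
  have fin: "finite P" using finite_partition_atLeastAtMost P .
  have "disjoint_family_on core P"
    unfolding disjoint_family_on_def using block_disjoint[OF P] core_sub by blast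
  moreover have "perfectly_matched G (core B)" if "B \<in> P" for B
    using structuredD(4)[OF G that] c[OF that]
    by (auto simp: core_def sound_block_def extendable_def factor_critical_def split: if_splits)
  ultimately have "perfectly_matched G (\<Union>B\<in>P. core B)"
    using perfectly_matched_UN fin by blast
  then obtain M where M: "M \<subseteq> G" "disjoint M" "\<Union>M = (\<Union>B\<in>P. core B)"
    unfolding perfectly_matched_def by blast
  have "2 * card M = card (\<Union>B\<in>P. core B)"
    using card_Union_matching[OF M(2), of n] M structuredD(1)[OF G] by simp
  also have "\<dots> = (\<Sum>B\<in>P. card (core B))"
    using fin finite_block[OF P] finite_subset[OF core_sub] \<open>disjoint_family_on core P\<close>
    by (intro card_UN_disjoint) (auto simp: disjoint_family_on_def)
  also have "\<dots> = (\<Sum>B\<in>P. 2 * (card B div 2))"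
  proof (rule sum.cong)
    fix B assume B: "B \<in> P"
    show "card (core B) = 2 * (card B div 2)"
      using c[OF B] finite_block[OF P B] by (auto simp: core_def elim: oddE)
  qed simp
  finally have "card M = block_matching P"
    by (simp add: block_matching_def flip: sum_distrib_left)
  moreover have "c B \<notin> \<Union>M" if B: "B \<in> P" "odd (card B)" for B
  proof
    assume "c B \<in> \<Union>M"
    then obtain C where C: "C \<in> P" "c B \<in> core C" using M by auto
    then have "C = B" using block_unique[OF P C(1) B(1)] core_sub c[OF B(1)] by blast
    then show False using C B by (simp add: core_def)
  qed
  ultimately show ?thesis using M(1,2) by (intro exI[of _ M]) auto
qed

text \<open>The blocks realise a matching of size \<open>block_matching P\<close>. Together with the
  converse below, this makes \<open>block_matching P\<close> the matching number of a structured
  position.\<close>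

lemma block_matching_less:
  assumes "structured n G P" "G \<notin> matching_property n k"
  shows "block_matching P < k"
proof (rule ccontr)
  assume "\<not> block_matching P < k"
  have c: "(SOME v. v \<in> B) \<in> B" if "B \<in> P" for B
    using that partition_onD3[OF structuredD(2)[OF assms(1)]] some_in_eq by metis
  obtain M where "M \<subseteq> G" "disjoint M" "card M = block_matching P"
    using structured_matching[where c = "\<lambda>B. SOME v. v \<in> B", OF assms(1) c] by auto
  then show False
    using assms(2) \<open>\<not> block_matching P < k\<close> matching_property_iff[OF structuredD(1)[OF assms(1)], of k]
    by auto
qed

lemma structured_not_matching_property:
  "structured n G P \<Longrightarrow> block_matching P < k \<Longrightarrow> G \<notin> matching_property n k"
  by (rule not_matching_property_if_inside[OF structuredD(2,1,3)])

lemma structured_insert_inside: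
  assumes "structured n G P" "e \<in> pairs n" "B \<in> P" "e \<subseteq> B"
  shows "structured n (insert e G) P"
proof -
  have "sound_block (insert e G) C" if "C \<in> P" for C
    using sound_block_mono[OF structuredD(4)[OF assms(1) that]] by blast
  then show ?thesis using assms by (auto simp: structured_def inside_def)
qed

lemma inside_merge:
  assumes "inside P G" "\<And>e. e \<in> H - G \<Longrightarrow> e \<subseteq> A \<union> B"
  shows "inside (merge P A B) H"
  unfolding inside_def
proof
  fix e assume "e \<in> H"
  show "\<exists>C\<in>merge P A B. e \<subseteq> C"
  proof (cases "e \<in> G")
    case True
    then obtain C where "C \<in> P" "e \<subseteq> C" using assms(1) by (auto simp: inside_def)
    then show ?thesis by (cases "C \<in> {A, B}") (auto simp: merge_def)
  next
    case False
    then have "e \<subseteq> A \<union> B" using assms(2) \<open>e \<in> H\<close> by blast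
    then show ?thesis by (simp add: merge_def)
  qed
qed

text \<open>\<open>H\<close> may exceed \<open>G\<close> by two edges at once, since the position
  between the opponent's edge and the repairing reply need not be structured.\<close>

lemma structured_merge:
  assumes G: "structured n G P" and AB: "A \<in> P" "B \<in> P"
    and H: "G \<subseteq> H" "H \<subseteq> pairs n" "\<And>e. e \<in> H - G \<Longrightarrow> e \<subseteq> A \<union> B"
    and "sound_block H (A \<union> B)"
  shows "structured n H (merge P A B)"
proof -
  have "partition_on {1..n} (merge P A B)"
    using partition_on_merge structuredD(2)[OF G] AB by blast
  moreover have "inside (merge P A B) H"
    using inside_merge structuredD(3)[OF G] H(3) by blast
  moreover have "\<forall>C\<in>merge P A B. sound_block H C"
    using structuredD(4)[OF G] sound_block_mono H(1) assms(7) by (auto simp: merge_def)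
  ultimately show ?thesis using H(2) by (simp add: structured_def)
qed

lemma cross_edge:
  assumes G: "structured n G P" and "A \<in> P" "B \<in> P" "A \<noteq> B" "u \<in> A" "v \<in> B"
  shows "{u, v} \<in> pairs n" "{u, v} \<notin> G"
proof -
  note P = structuredD(2)[OF G]
  have "u \<noteq> v" using block_disjoint[OF P assms(2-4)] assms(5,6) by blast
  moreover have "u \<in> {1..n}" "v \<in> {1..n}"
    unfolding partition_onD1[OF P] using assms(2,3,5,6) by auto
  ultimately show "{u, v} \<in> pairs n" by (simp add: doubleton_in_pairs)
  show "{u, v} \<notin> G"
  proof
    assume "{u, v} \<in> G"
    then obtain C where "C \<in> P" "u \<in> C" "v \<in> C"
      using structuredD(3)[OF G] by (auto simp: inside_def)
    then show False using block_unique[OF P] assms by metis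
  qed
qed

lemma card_Un_blocks:
  assumes "partition_on {1..n::nat} P" "A \<in> P" "B \<in> P" "A \<noteq> B"
  shows "card (A \<union> B) = card A + card B"
  by (rule card_Un_disjoint[OF finite_block[OF assms(1,2)] finite_block[OF assms(1,3)] block_disjoint[OF assms]])

lemma structured_join_odd:
  assumes G: "structured n G P" and AB: "A \<in> P" "B \<in> P" "A \<noteq> B" "odd (card A)" "odd (card B)"
    and uv: "u \<in> A" "v \<in> B"
  shows "structured n (insert {u, v} G) (merge P A B)"
proof (rule structured_merge[OF G AB(1,2)])
  let ?H = "insert {u, v} G"
  have "factor_critical ?H A" "factor_critical ?H B"
    using structuredD(4)[OF G] AB factor_critical_mono[OF _ subset_insertI] by (auto simp: sound_block_def)
  then have "extendable ?H (A \<union> B)"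
    using block_disjoint[OF structuredD(2)[OF G] AB(1-3)] uv
    by (intro extendable_join_factor_critical[of _ _ _ u v]) auto
  then show "sound_block ?H (A \<union> B)"
    using AB card_Un_blocks[OF structuredD(2)[OF G] AB(1-3)] by (simp add: sound_block_def)
  show "?H \<subseteq> pairs n" using structuredD(1)[OF G] cross_edge(1)[OF G AB(1-3) uv] by simp
qed (use uv in auto)

section \<open>Moves that preserve the structure\<close>

lemma subset_block_pairs: "G \<subseteq> pairs n \<Longrightarrow> inside P G \<Longrightarrow> G \<subseteq> block_pairs P"
  by (auto simp: inside_def block_pairs_def pairs_def)

text \<open>An even block keeps the game alive at matching number \<open>k - 1\<close>: an edge from
  it to another block does not raise the matching number.\<close>

definition has_even_block :: "nat set set \<Rightarrow> bool" where
  "has_even_block P \<longleftrightarrow> (\<exists>B\<in>P. even (card B))"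

text \<open>
  If every block is complete, the number of edges has the parity of the matching number.
  Hence the player who has to move with the wrong parity for \<open>k - 1\<close> can either add an edge inside a
  block or raise the matching number.
\<close>

lemma tempo_move:
  assumes G: "structured n G P" and less: "block_matching P < k" and parity: "even (card G + k)"
    and n: "2 * k \<le> n"
  shows "\<exists>f\<in>legal_edges n (matching_property n k) G. \<exists>Q. structured n (insert f G) Q \<and>
    block_matching Q < k \<and> (Q = P \<or> has_even_block Q)"
proof (cases "G = block_pairs P")
  case False
  have "G \<subseteq> block_pairs P"
    using subset_block_pairs structuredD(1,3)[OF G] by blast
  with False obtain f where f: "f \<in> block_pairs P" "f \<notin> G" by blast
  then obtain B where B: "B \<in> P" "f \<subseteq> B" "card f = 2" by (auto simp: block_pairs_def)
  then have "f \<in> pairs n"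
    unfolding pairs_def partition_onD1[OF structuredD(2)[OF G]] by auto
  moreover from this have st: "structured n (insert f G) P" using structured_insert_inside[OF G] B by blast
  ultimately have "f \<in> legal_edges n (matching_property n k) G"
    using f structured_not_matching_property[OF st less] by (simp add: legal_edges_def)
  then show ?thesis using st less by blast
next
  case True
  note P = structuredD(2)[OF G]
  have "even (block_matching P + k)"
    using parity even_card_block_pairs[OF P] True by simp
  \<comment> \<open>Parity excludes matching number \<open>k - 1\<close>, so there is room to join
    two odd blocks.\<close>
  then have "Suc (block_matching P) \<noteq> k" by auto
  then have less': "Suc (block_matching P) < k" using less by simp
  then obtain A B where AB: "A \<in> P" "B \<in> P" "A \<noteq> B" "odd (card A)" "odd (card B)"
    using obtain_odd_blocks[OF P, of thesis] n by auto
  obtain u v where uv: "u \<in> A" "v \<in> B" using AB by (metis card.empty even_zero ex_in_conv)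
  have st: "structured n (insert {u, v} G) (merge P A B)"
    using structured_join_odd[OF G AB uv] .
  moreover have bm: "block_matching (merge P A B) < k"
    using block_matching_merge[OF P AB(1-3)] AB less' by simp
  moreover have "has_even_block (merge P A B)"
    using AB card_Un_blocks[OF P AB(1-3)] by (auto simp: has_even_block_def merge_def)
  moreover have "{u, v} \<in> legal_edges n (matching_property n k) G"
    using cross_edge[OF G AB(1-3) uv] structured_not_matching_property[OF st bm]
    by (simp add: legal_edges_def)
  ultimately show ?thesis by blast
qed

text \<open>Repairing after such an edge merges the even block into an odd one and may use up the
  last even block. At matching number \<open>k - 1\<close> Max therefore answers by pinning.\<close>

definition odd_even_cross :: "nat set set \<Rightarrow> nat set \<Rightarrow> bool" where
  "odd_even_cross P e \<longleftrightarrow>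
    (\<exists>A\<in>P. \<exists>B\<in>P. \<exists>x\<in>A. \<exists>a\<in>B. odd (card A) \<and> even (card B) \<and> e = {x, a})"

text \<open>The last condition of the cross case fixes the order: of two blocks of different parity,
  the odd one comes first.\<close>

lemma edge_cases:
  assumes P: "partition_on {1..n} P" and "e \<in> pairs n"
  obtains (same) B where "B \<in> P" "e \<subseteq> B"
    | (cross) A B u v where "A \<in> P" "B \<in> P" "A \<noteq> B" "u \<in> A" "v \<in> B" "e = {u, v}"
      "even (card A) \<Longrightarrow> even (card B)"
proof -
  obtain u v where uv: "e = {u, v}" "u \<noteq> v" using assms(2) by (auto simp: pairs_def card_2_iff)
  then have "u \<in> \<Union>P" "v \<in> \<Union>P" using assms(2) partition_onD1[OF P] by (auto simp: pairs_def)
  then obtain A B where AB: "A \<in> P" "B \<in> P" "u \<in> A" "v \<in> B" by blast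
  show thesis
  proof (cases "A = B")
    case True
    then show ?thesis using same AB uv by blast
  next
    case False
    have "e = {v, u}" using uv by auto
    then show ?thesis
      using cross[of A B u v] cross[of B A v u] False AB uv by blast
  qed
qed

text \<open>An edge inside a block or between two odd blocks leaves a structured position, and a
  tempo move follows. An edge at an even block is answered between the same two blocks. The final
  implication carries the extra invariant of Max.\<close>

lemma reply_move:
  assumes G: "structured n G P" and less: "block_matching P < k" and parity: "odd (card G + k)"
    and n: "2 * k \<le> n" and e: "e \<in> legal_edges n (matching_property n k) G"
  shows "\<exists>f\<in>legal_edges n (matching_property n k) (insert e G). \<exists>Q.
    structured n (insert f (insert e G)) Q \<and> block_matching Q < k \<and>
    (Suc (block_matching P) < k \<or> has_even_block P \<and> \<not> odd_even_cross P e \<longrightarrow>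
     Suc (block_matching Q) < k \<or> has_even_block Q)"
proof -
  note P = structuredD(2)[OF G]
  have e': "e \<in> pairs n" "e \<notin> G" "insert e G \<notin> matching_property n k"
    using e by (auto simp: legal_edges_def)
  have "finite G" using structuredD(1)[OF G] finite_pairs finite_subset by blast
  then have parity': "even (card (insert e G) + k)" using parity e' by simp
  \<comment> \<open>Common end of both cases with an even block \<open>B\<close>: once the merged
    block is sound, \<open>{p, q}\<close> is legal because the matching number is unchanged.\<close>
  have merged: ?thesis
    if AB: "A \<in> P" "B \<in> P" "A \<noteq> B" "even (card B)" "u \<in> A" "v \<in> B" "e = {u, v}"
      and pq: "p \<in> A" "q \<in> B" "{p, q} \<noteq> {u, v}"
      and sound: "sound_block (insert {p, q} (insert e G)) (A \<union> B)"
    for A B u v p q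
  proof -
    let ?H = "insert {p, q} (insert e G)"
    have f: "{p, q} \<in> pairs n" "{p, q} \<notin> insert e G"
      using cross_edge[OF G AB(1-3) pq(1,2)] pq(3) AB by auto
    have st: "structured n ?H (merge P A B)"
      using sound structuredD(1)[OF G] f e' AB pq by (intro structured_merge[OF G AB(1,2)]) auto
    have bm: "block_matching (merge P A B) = block_matching P"
      using block_matching_merge[OF P AB(1-3)] AB(4) by simp
    have "{p, q} \<in> legal_edges n (matching_property n k) (insert e G)"
      using f structured_not_matching_property[OF st] bm less by (simp add: legal_edges_def)
    moreover have "has_even_block (merge P A B)" if "\<not> odd_even_cross P e"
    proof -
      have "even (card A)" using that AB unfolding odd_even_cross_def by blast
      then have "even (card (A \<union> B))" using card_Un_blocks[OF P AB(1-3)] AB by simp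
      then show ?thesis by (auto simp: has_even_block_def merge_def)
    qed
    ultimately show ?thesis using st bm less by (intro bexI[of _ "{p, q}"] exI[of _ "merge P A B"]) auto
  qed
  have partner: "\<exists>b. completes G B a b" if "B \<in> P" "even (card B)" "a \<in> B" for a B
    using structuredD(4)[OF G that(1)] that by (auto simp: sound_block_def extendable_def)
  from P e'(1) show ?thesis
  proof (cases rule: edge_cases)
    case (same B)
    then have "structured n (insert e G) P" using structured_insert_inside[OF G e'(1)] by blast
    from tempo_move[OF this less parity' n] show ?thesis by fastforce
  next
    case (cross A B u v)
    consider "odd (card A)" "odd (card B)" | "odd (card A)" "even (card B)" | "even (card A)" "even (card B)"
      using cross(7) by blast
    then show ?thesis
    proof cases
      case 1
      have st: "structured n (insert e G) (merge P A B)"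
        using structured_join_odd[OF G cross(1-3) 1 cross(4,5)] cross(6) by simp
      have "has_even_block (merge P A B)"
        using 1 card_Un_blocks[OF P cross(1-3)] by (auto simp: has_even_block_def merge_def)
      \<comment> \<open>Here the matching number has grown; that it is still below \<open>k\<close>
        follows from the legality of \<open>e\<close>.\<close>
      then show ?thesis
        using tempo_move[OF st block_matching_less[OF st e'(3)] parity' n] by blast
    next
      case 2
      \<comment> \<open>The reply gives \<open>u\<close> a second neighbour \<open>b\<close> in
        \<open>B\<close>, which makes the odd union factor-critical.\<close>
      obtain b where b: "completes G B v b" using partner cross 2 by blast
      then have bB: "b \<in> B" "b \<noteq> v" using completes_neq[OF b] by (auto simp: completes_def)
      let ?H = "insert {u, b} (insert e G)"
      have sub: "G \<subseteq> ?H" by auto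
      have "factor_critical ?H A" "extendable ?H B"
        using structuredD(4)[OF G] cross 2 factor_critical_mono[OF _ sub] extendable_mono[OF _ sub]
        by (auto simp: sound_block_def)
      then have "factor_critical ?H (A \<union> B)"
        using completes_mono[OF b sub] block_disjoint[OF P cross(1-3)] cross
        by (intro factor_critical_join_extendable[of _ _ _ v b u]) auto
      then have "sound_block ?H (A \<union> B)"
        using 2 card_Un_blocks[OF P cross(1-3)] by (simp add: sound_block_def)
      moreover have "{u, b} \<noteq> {u, v}" using bB by (auto simp: doubleton_eq_iff)
      ultimately show ?thesis using merged cross 2 bB by blast
    next
      case 3
      \<comment> \<open>The reply joins the partners of \<open>u\<close> and
        \<open>v\<close>.\<close>
      obtain p q where pq: "completes G A u p" "completes G B v q" using partner cross 3 by meson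
      then have in_blocks: "p \<in> A" "q \<in> B" "p \<noteq> u"
        using completes_neq[OF pq(1)] by (auto simp: completes_def)
      let ?H = "insert {p, q} (insert e G)"
      have sub: "G \<subseteq> ?H" by auto
      have dj: "A \<inter> B = {}" using block_disjoint[OF P cross(1-3)] .
      have "extendable ?H A" "extendable ?H B"
        using structuredD(4)[OF G] cross 3 extendable_mono[OF _ sub] by (auto simp: sound_block_def)
      then have "extendable ?H (A \<union> B)"
        using completes_mono[OF pq(1) sub] completes_mono[OF pq(2) sub] dj cross
        by (intro extendable_join_extendable[of _ _ u p _ v q]) auto
      then have "sound_block ?H (A \<union> B)"
        using 3 card_Un_blocks[OF P cross(1-3)] by (simp add: sound_block_def)
      moreover have "{p, q} \<noteq> {u, v}" using in_blocks dj cross by (auto simp: doubleton_eq_iff)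
      ultimately show ?thesis using merged[of A B u v p q] cross 3 in_blocks by blast
    qed
  qed
qed

section \<open>A vertex that becomes universal\<close>

text \<open>One maximum matching misses two neighbours of \<open>a\<close>. Phrased through a fixed
  matching \<open>M\<close> of size \<open>k - 1\<close>, the condition survives every further legal
  edge.\<close>

definition pinned :: "nat \<Rightarrow> nat \<Rightarrow> nat \<Rightarrow> graph \<Rightarrow> bool" where
  "pinned n k a G \<longleftrightarrow> G \<subseteq> pairs n \<and> G \<notin> matching_property n k \<and>
    (\<exists>M\<subseteq>G. disjoint M \<and> Suc (card M) = k \<and>
      (\<exists>x y. x \<noteq> y \<and> x \<notin> \<Union>M \<and> y \<notin> \<Union>M \<and> {a, x} \<in> G \<and> {a, y} \<in> G))"

lemma pinned_insert:
  assumes "pinned n k a G" "e \<in> legal_edges n (matching_property n k) G"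
  shows "pinned n k a (insert e G)"
proof -
  obtain M x y where M: "M \<subseteq> G" "disjoint M" "Suc (card M) = k"
    and xy: "x \<noteq> y" "x \<notin> \<Union>M" "y \<notin> \<Union>M" "{a, x} \<in> G" "{a, y} \<in> G"
    using assms(1) unfolding pinned_def by blast
  have "M \<subseteq> insert e G" "{a, x} \<in> insert e G" "{a, y} \<in> insert e G"
    using M xy by auto
  moreover have "insert e G \<subseteq> pairs n" "insert e G \<notin> matching_property n k"
    using assms by (auto simp: legal_edges_def pinned_def)
  ultimately show ?thesis
    unfolding pinned_def using M(2,3) xy(1-3) by blast
qed

text \<open>
  By the exchange lemma every matching of size \<open>k - 1\<close> covers \<open>a\<close>: otherwise some such matching
  would miss \<open>a\<close> together with \<open>x\<close> or \<open>y\<close>.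
\<close>

lemma pinned_legal:
  assumes pin: "pinned n k a G" and w: "{a, w} \<in> pairs n" "{a, w} \<notin> G"
  shows "{a, w} \<in> legal_edges n (matching_property n k) G"
proof (rule ccontr)
  assume "\<not> ?thesis"
  then have "insert {a, w} G \<in> matching_property n k" using w by (simp add: legal_edges_def)
  then obtain K where K: "K \<subseteq> insert {a, w} G" "disjoint K" "card K = k"
    unfolding matching_property_def matching_def by blast
  obtain M x y where M: "M \<subseteq> G" "disjoint M" "Suc (card M) = k"
    and xy: "x \<noteq> y" "x \<notin> \<Union>M" "y \<notin> \<Union>M" "{a, x} \<in> G" "{a, y} \<in> G"
    and G: "G \<subseteq> pairs n" "G \<notin> matching_property n k"
    using pin unfolding pinned_def by blast
  have max: "card L < k" if "L \<subseteq> G" "disjoint L" for L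
    using G that matching_property_iff[OF G(1)] not_less by blast
  have aw: "{a, w} \<in> K" using max[of K] K by blast
  \<comment> \<open>Without \<open>{a, w}\<close>, the matching \<open>K\<close> becomes one of size
    \<open>k - 1\<close> in \<open>G\<close> that misses \<open>a\<close>.\<close>
  define N where "N = K - {{a, w}}"
  have N: "N \<subseteq> G" "disjoint N" "a \<notin> \<Union>N"
    using K Union_Diff_singleton_disjoint[OF K(2) aw] pairwise_subset[OF K(2), of N]
    by (auto simp: N_def)
  have fin: "finite G" using G(1) finite_pairs finite_subset by blast
  then have finMN: "finite M" "finite N" "finite K" using M N K finite_subset by blast+
  have "card M = card N" using card_Suc_Diff1[OF finMN(3) aw] K(3) M(3) by (simp add: N_def)
  moreover have "card L \<le> card M" if "L \<subseteq> M \<union> N" "disjoint L" for L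
  proof -
    have "L \<subseteq> G" using that M N by blast
    then show ?thesis using max[of L] that M(3) by auto
  qed
  moreover have "\<forall>e\<in>M \<union> N. card e = 2" using M N G pairsD by blast
  ultimately obtain M' z where M': "M' \<subseteq> M \<union> N" "disjoint M'" "card M' = card M" "a \<notin> \<Union>M'"
      "\<Union>M' \<subseteq> insert z (\<Union>M)"
    using matching_exchange[of M N a] finMN M N by blast
  \<comment> \<open>\<open>M'\<close> covers at most one vertex that \<open>M\<close> misses. The
    exposed one of \<open>x\<close> and \<open>y\<close>, joined to \<open>a\<close>, enlarges
    \<open>M'\<close> to a matching of size \<open>k\<close> in \<open>G\<close>.\<close>
  have "x \<notin> \<Union>M' \<or> y \<notin> \<Union>M'" using M'(5) xy(1-3) by blast
  then obtain t where t: "t \<notin> \<Union>M'" "{a, t} \<in> G" using xy by blast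
  have "disjoint (insert {a, t} M')" "{a, t} \<notin> M'"
    using disjoint_insertI[OF M'(2), of "{a, t}"] M' t by blast+
  moreover have "finite M'" using M' finMN finite_subset by blast
  moreover have "insert {a, t} M' \<subseteq> G" using M' M N t by blast
  ultimately show False
    using max[of "insert {a, t} M'"] M'(3) M(3) by simp
qed

text \<open>Edges at \<open>a\<close> stay legal until they are played, so the final graph contains
  the full star at \<open>a\<close>, however the play goes.\<close>

lemma pinned_game_value:
  assumes "pinned n k a G"
  shows "n - 1 \<le> game_value n (matching_property n k) p G"
proof (rule game_value_invariant[where Q = "pinned n k a" and R = "\<lambda>s. n - 1 \<le> s", OF assms])
  fix G assume pin: "pinned n k a G" and over: "legal_edges n (matching_property n k) G = {}"
  have "finite G" "a \<in> {1..n}"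
    using pin finite_pairs finite_subset unfolding pinned_def pairs_def by blast+
  have "{a, w} \<in> G" if "w \<in> {1..n} - {a}" for w
    using pinned_legal[OF pin, of w] over that \<open>a \<in> {1..n}\<close> by (auto simp: doubleton_in_pairs)
  then have "(\<lambda>w. {a, w}) ` ({1..n} - {a}) \<subseteq> G" by blast
  then have "card ((\<lambda>w. {a, w}) ` ({1..n} - {a})) \<le> card G"
    using \<open>finite G\<close> card_mono by blast
  moreover have "inj_on (\<lambda>w. {a, w}) ({1..n} - {a})"
    by (auto simp: inj_on_def doubleton_eq_iff)
  ultimately show "n - 1 \<le> card G"
    using \<open>a \<in> {1..n}\<close> by (simp add: card_image)
qed (rule pinned_insert)

text \<open>
  Two edges at \<open>a\<close> cannot lie in a common matching, so the second one is legal because each of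
  them is harmless on its own.
\<close>

lemma pinning_reply:
  assumes G: "structured n G P" and full: "Suc (block_matching P) = k" and n: "2 * k \<le> n"
    and e: "e \<in> legal_edges n (matching_property n k) G" "odd_even_cross P e"
  shows "\<exists>f\<in>legal_edges n (matching_property n k) (insert e G). \<exists>a. pinned n k a (insert f (insert e G))"
proof -
  note P = structuredD(2)[OF G]
  obtain A B x a where AB: "A \<in> P" "B \<in> P" "x \<in> A" "a \<in> B" "odd (card A)" "even (card B)" "e = {x, a}"
    using e(2) unfolding odd_even_cross_def by blast
  have "2 * block_matching P + 2 \<le> n" using full n by simp
  \<comment> \<open>At least two blocks are odd, so one other than \<open>A\<close> can supply the
    second exposed neighbour of \<open>a\<close>.\<close>
  then obtain C where C: "C \<in> P" "odd (card C)" "C \<noteq> A" using obtain_odd_blocks[OF P] by metis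
  obtain y where y: "y \<in> C" using C by (metis card.empty even_zero ex_in_conv)
  have neq: "C \<noteq> B" using AB C by auto
  have "x \<noteq> y" using block_unique[OF P AB(1) C(1)] AB y C by blast
  let ?f = "{y, a}" and ?H = "insert {y, a} (insert e G)"
  have f: "?f \<in> pairs n" "?f \<notin> G" using cross_edge[OF G C(1) AB(2) neq y AB(4)] by auto
  have "?f \<noteq> e" using \<open>x \<noteq> y\<close> AB by (auto simp: doubleton_eq_iff)
  have e': "e \<in> pairs n" "insert e G \<notin> matching_property n k" using e(1) by (auto simp: legal_edges_def)
  have sub: "?H \<subseteq> pairs n" "insert e G \<subseteq> pairs n" "insert ?f G \<subseteq> pairs n"
    using structuredD(1)[OF G] f e' by auto
  \<comment> \<open>Joining the odd block \<open>C\<close> to the even block \<open>B\<close> leaves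
    \<open>block_matching\<close> at \<open>k - 1\<close>.\<close>
  have fG: "insert ?f G \<notin> matching_property n k"
  proof (rule not_matching_property_if_inside)
    show "partition_on {1..n} (merge P C B)" using partition_on_merge P C AB by blast
    show "inside (merge P C B) (insert ?f G)"
      using structuredD(3)[OF G] y AB by (intro inside_merge) auto
    show "block_matching (merge P C B) < k"
      using block_matching_merge[OF P C(1) AB(2) neq] AB full by simp
  qed (use sub in simp)
  have H: "?H \<notin> matching_property n k"
  proof
    assume "?H \<in> matching_property n k"
    then obtain K where K: "K \<subseteq> ?H" "disjoint K" "k \<le> card K"
      using matching_property_iff[OF sub(1)] by blast
    have "e \<inter> ?f \<noteq> {}" using AB by blast
    then have "e \<notin> K \<or> ?f \<notin> K" using disjointD[OF K(2), of e ?f] \<open>?f \<noteq> e\<close> by metis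
    then have "K \<subseteq> insert ?f G \<or> K \<subseteq> insert e G" using K(1) by blast
    moreover have "\<not> K \<subseteq> insert ?f G" using fG K(2,3) matching_property_iff[OF sub(3), of k] by auto
    moreover have "\<not> K \<subseteq> insert e G" using e'(2) K(2,3) matching_property_iff[OF sub(2), of k] by auto
    ultimately show False by blast
  qed
  \<comment> \<open>The exposed vertices are to be \<open>x\<close> in \<open>A\<close> and
    \<open>y\<close> in \<open>C\<close>; in other blocks the choice is arbitrary.\<close>
  have c: "(if D = A then x else if D = C then y else SOME v. v \<in> D) \<in> D" if "D \<in> P" for D
  proof -
    have "D \<noteq> {}" using that partition_onD3[OF P] by blast
    then show ?thesis using AB(3) y by (simp add: some_in_eq)
  qed
  obtain M where M: "M \<subseteq> G" "disjoint M" "card M = block_matching P"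
    "\<forall>D\<in>P. odd (card D) \<longrightarrow> (if D = A then x else if D = C then y else SOME v. v \<in> D) \<notin> \<Union>M"
    using structured_matching[where c = "\<lambda>D. if D = A then x else if D = C then y else SOME v. v \<in> D",
        OF G c] by auto
  have "x \<notin> \<Union>M" "y \<notin> \<Union>M"
    using bspec[OF M(4) AB(1)] bspec[OF M(4) C(1)] AB(5) C(2,3) by auto
  moreover have "{a, x} \<in> ?H" "{a, y} \<in> ?H" using AB by (auto simp: insert_commute)
  moreover have "M \<subseteq> ?H" "Suc (card M) = k" using M full by auto
  ultimately have "pinned n k a ?H"
    unfolding pinned_def using sub(1) H M(2) \<open>x \<noteq> y\<close> by blast
  moreover have "?f \<in> legal_edges n (matching_property n k) (insert e G)"
    using f \<open>?f \<noteq> e\<close> H by (simp add: legal_edges_def)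
  ultimately show ?thesis by blast
qed

text \<open>Two blocks can be joined without reaching matching number \<open>k\<close>: two odd ones
  below \<open>k - 1\<close>, an odd and an even one at \<open>k - 1\<close>.\<close>

lemma ready_position_has_legal_edge:
  assumes G: "structured n G P" and n: "2 * k \<le> n" and less: "block_matching P < k"
    and ready: "Suc (block_matching P) < k \<or> has_even_block P"
  shows "legal_edges n (matching_property n k) G \<noteq> {}"
proof -
  note P = structuredD(2)[OF G]
  obtain A B where AB: "A \<in> P" "B \<in> P" "A \<noteq> B" "block_matching (merge P A B) < k"
  proof -
    have "2 * block_matching P + 2 \<le> n" using less n by simp
    then obtain A C where AC: "A \<in> P" "C \<in> P" "A \<noteq> C" "odd (card A)" "odd (card C)"
      using obtain_odd_blocks[OF P] by blast
    show thesis
    proof (cases "Suc (block_matching P) < k")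
      case True
      then show ?thesis using that[OF AC(1-3)] block_matching_merge[OF P AC(1-3)] by simp
    next
      case False
      then obtain B where B: "B \<in> P" "even (card B)" using ready by (auto simp: has_even_block_def)
      then have "A \<noteq> B" using AC by auto
      then show ?thesis using that[OF AC(1) B(1)] block_matching_merge[OF P AC(1) B(1)] B less by simp
    qed
  qed
  obtain u v where uv: "u \<in> A" "v \<in> B" using AB partition_onD3[OF P] by (metis ex_in_conv)
  have "insert {u, v} G \<notin> matching_property n k"
  proof (rule not_matching_property_if_inside[OF partition_on_merge[OF P AB(1,2)] _ _ AB(4)])
    show "insert {u, v} G \<subseteq> pairs n"
      using cross_edge(1)[OF G AB(1-3) uv] structuredD(1)[OF G] by simp
    show "inside (merge P A B) (insert {u, v} G)"
      using structuredD(3)[OF G] uv by (intro inside_merge) auto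
  qed
  then show ?thesis using cross_edge[OF G AB(1-3) uv] by (auto simp: legal_edges_def)
qed

section \<open>The score of the matching game\<close>

text \<open>Invariant for the moments when the opponent is to move; the parity condition says that
  the number of edges is \<open>k - 1\<close> modulo 2.\<close>

definition Mini_position :: "nat \<Rightarrow> nat \<Rightarrow> graph \<Rightarrow> bool" where
  "Mini_position n k G \<longleftrightarrow> odd (card G + k) \<and> (\<exists>P. structured n G P \<and> block_matching P < k)"

definition Max_position :: "nat \<Rightarrow> nat \<Rightarrow> graph \<Rightarrow> bool" where
  "Max_position n k G \<longleftrightarrow> odd (card G + k) \<and> (\<exists>P. structured n G P \<and> block_matching P < k \<and>
     (Suc (block_matching P) < k \<or> has_even_block P))"

lemma odd_card_insert_insert:
  assumes "finite G" "e \<in> legal_edges n P G" "f \<in> legal_edges n P (insert e G)" "odd (card G + k)"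
  shows "odd (card (insert f (insert e G)) + k)"
  using assms by (simp add: legal_edges_def)

lemma structured_finite: "structured n G P \<Longrightarrow> finite G"
  by (rule finite_subset[OF structuredD(1) finite_pairs])

lemma Mini_position_value:
  assumes "2 * k \<le> n" "Mini_position n k G"
  shows "game_value n (matching_property n k) player.Max G \<le> (2 * k - 1) choose 2"
proof (rule Mini_strategy[where Q = "Mini_position n k", OF assms(2)])
  fix G e assume G: "Mini_position n k G" and e: "e \<in> legal_edges n (matching_property n k) G"
  then obtain P where P: "structured n G P" "block_matching P < k" "odd (card G + k)"
    by (auto simp: Mini_position_def)
  from reply_move[OF P assms(1) e] obtain f Q where f: "f \<in> legal_edges n (matching_property n k) (insert e G)"
      and Q: "structured n (insert f (insert e G)) Q" "block_matching Q < k"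
    by blast
  then have "Mini_position n k (insert f (insert e G))"
    using odd_card_insert_insert[OF structured_finite[OF P(1)] e f P(3)] unfolding Mini_position_def by blast
  then show "\<exists>f\<in>legal_edges n (matching_property n k) (insert e G). Mini_position n k (insert f (insert e G))"
    using f by blast
next
  fix G assume "Mini_position n k G"
  then obtain P where G: "structured n G P" "block_matching P < k" by (auto simp: Mini_position_def)
  note P = structuredD(2)[OF G(1)]
  have sub: "G \<subseteq> block_pairs P"
    using subset_block_pairs structuredD(1,3)[OF G(1)] by blast
  have "finite (block_pairs P)"
    using finite_partition_atLeastAtMost[OF P] finite_block[OF P] by (auto simp: block_pairs_def)
  then have "card G \<le> card (block_pairs P)" using sub card_mono by blast
  also have "\<dots> \<le> (2 * block_matching P + 1) choose 2" using card_block_pairs_le[OF P] .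
  also have "\<dots> \<le> (2 * k - 1) choose 2" using G(2) by (intro binomial_right_mono) simp
  finally show "card G \<le> (2 * k - 1) choose 2" .
qed

lemma Max_position_value:
  assumes n: "2 * k \<le> n" and "Max_position n k G"
  shows "n - 1 \<le> game_value n (matching_property n k) player.Mini G"
proof (rule Max_strategy[where Q = "Max_position n k", OF assms(2)])
  fix G assume "Max_position n k G"
  then show "legal_edges n (matching_property n k) G \<noteq> {}"
    using ready_position_has_legal_edge n unfolding Max_position_def by blast
next
  fix G e assume G: "Max_position n k G" and e: "e \<in> legal_edges n (matching_property n k) G"
  then obtain P where P: "structured n G P" "block_matching P < k" "odd (card G + k)"
      and ready: "Suc (block_matching P) < k \<or> has_even_block P"
    by (auto simp: Max_position_def)
  show "\<exists>f\<in>legal_edges n (matching_property n k) (insert e G). Max_position n k (insert f (insert e G)) \<or>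
      n - 1 \<le> game_value n (matching_property n k) player.Mini (insert f (insert e G))"
  proof (cases "Suc (block_matching P) = k \<and> odd_even_cross P e")
    case True
    then show ?thesis using pinning_reply[OF P(1) _ n e] pinned_game_value by blast
  next
    case False
    then have "Suc (block_matching P) < k \<or> has_even_block P \<and> \<not> odd_even_cross P e"
      using ready P(2) by auto
    with reply_move[OF P n e] obtain f Q where f: "f \<in> legal_edges n (matching_property n k) (insert e G)"
      and Q: "structured n (insert f (insert e G)) Q" "block_matching Q < k"
        "Suc (block_matching Q) < k \<or> has_even_block Q"
      by blast
    then have "Max_position n k (insert f (insert e G))"
      using odd_card_insert_insert[OF structured_finite[OF P(1)] e f P(3)] unfolding Max_position_def by blast
    then show ?thesis using f by blast
  qed
qed

section \<open>Boards with fewer than \<open>2 * k\<close> vertices, and the opening\<close>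

lemma matching_property_empty:
  assumes "n < 2 * k"
  shows "matching_property n k = {}"
proof -
  have "card M < k" if "M \<subseteq> pairs n" "disjoint M" for M
  proof -
    have "\<Union>M \<subseteq> {1..n}" using that(1) by (auto simp: pairs_def)
    then have "card (\<Union>M) \<le> card {1..n}" by (intro card_mono) auto
    then show ?thesis using card_Union_matching[OF that(2,1)] assms by simp
  qed
  then have "\<not> (\<exists>M. matching G M \<and> card M = k)" if "G \<subseteq> pairs n" for G
    using that unfolding matching_def by (metis less_irrefl order_trans)
  then show ?thesis by (simp add: matching_property_def)
qed

lemma game_value_small:
  assumes "n < 2 * k"
  shows "game_value n (matching_property n k) p {} = n choose 2"
proof (rule game_value_invariant[where Q = "\<lambda>G. G \<subseteq> pairs n" and R = "\<lambda>s. s = n choose 2"])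
  fix G assume "G \<subseteq> pairs n" "legal_edges n (matching_property n k) G = {}"
  then have "G = pairs n" using matching_property_empty[OF assms] by (auto simp: legal_edges_def)
  then show "card G = n choose 2" by (simp add: card_pairs)
qed (auto simp: legal_edges_def)

lemma pred_le_choose_2: "n - 1 \<le> n choose 2"
proof (cases n)
  case (Suc m)
  then show ?thesis by (cases m) (simp_all add: numeral_2_eq_2)
qed simp

lemma score_ge:
  assumes k: "k \<ge> 2" and first: "first = player.Max \<and> even k \<or> first = player.Mini \<and> odd k"
  shows "n - 1 \<le> score n first (matching_property n k)"
proof (cases "2 * k \<le> n")
  case False
  then show ?thesis using game_value_small pred_le_choose_2 by (simp add: score_def)
next
  case True
  let ?P = "(\<lambda>v. {v}) ` {1..n}"
  \<comment> \<open>Singletons are all odd, but \<open>k \<ge> 2\<close> puts the matching number 0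
    below \<open>k - 1\<close>, so Max can start without an even block.\<close>
  have less: "block_matching ?P < k" "Suc (block_matching ?P) < k"
    using k block_matching_singletons by simp_all
  show ?thesis
  proof (cases "even k")
    case False
    then have "Max_position n k {}"
      unfolding Max_position_def using less by (auto intro!: exI[of _ ?P] structured_empty)
    then show ?thesis using Max_position_value[OF True] False first by (simp add: score_def)
  next
    \<comment> \<open>The empty graph has the wrong parity for even \<open>k\<close>; Max moves
      first and corrects it with a tempo move.\<close>
    case even: True
    obtain f Q where f: "f \<in> legal_edges n (matching_property n k) {}"
      and Q: "structured n {f} Q" "block_matching Q < k" "Q = ?P \<or> has_even_block Q"
      using tempo_move[OF structured_empty less(1) _ True] even by auto
    then have "Max_position n k {f}" unfolding Max_position_def using even less by auto
    then show ?thesis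
      using Max_position_value[OF True] game_value_Max_ge[OF f] even first by (simp add: score_def)
  qed
qed

lemma score_le:
  assumes k: "k \<ge> 2" and first: "first = player.Max \<and> odd k \<or> first = player.Mini \<and> even k"
  shows "score n first (matching_property n k) \<le> (2 * k - 1) choose 2"
proof (cases "2 * k \<le> n")
  case False
  then show ?thesis using game_value_small[of n k] by (auto simp: score_def intro: binomial_right_mono)
next
  case True
  let ?P = "(\<lambda>v. {v}) ` {1..n}"
  have less: "block_matching ?P < k"
    using k block_matching_singletons by simp
  show ?thesis
  proof (cases "even k")
    case False
    then have "Mini_position n k {}"
      unfolding Mini_position_def using less by (auto intro!: exI[of _ ?P] structured_empty)
    then show ?thesis using Mini_position_value[OF True] False first by (simp add: score_def)
  next
    case even: True
    obtain f Q where f: "f \<in> legal_edges n (matching_property n k) {}"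
      and Q: "structured n {f} Q" "block_matching Q < k"
      using tempo_move[OF structured_empty less _ True] even by auto
    then have "Mini_position n k {f}" unfolding Mini_position_def using even by auto
    then show ?thesis
      using Mini_position_value[OF True] game_value_Mini_le[OF f] even first by (simp add: score_def)
  qed
qed

theorem theorem1p7:
  fixes n k :: nat and first :: player
  assumes "k \<ge> 2"
  shows "((first = player.Max \<and> even k) \<or> (first = player.Mini \<and> odd k)
            \<longrightarrow> int (score n first (matching_property n k)) \<ge> int n - 1)
       \<and> ((first = player.Max \<and> odd k) \<or> (first = player.Mini \<and> even k)
            \<longrightarrow> score n first (matching_property n k) \<le> (2 * k - 1) choose 2)"
proof (intro conjI impI)
  assume "first = player.Max \<and> even k \<or> first = player.Mini \<and> odd k"
  from score_ge[OF assms this, of n]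
  \<comment> \<open>For \<open>n = 0\<close> the truncated \<open>n - 1\<close> is 0 and
    \<open>int n - 1\<close> is negative, so the bound over the naturals implies this one.\<close>
  show "int (score n first (matching_property n k)) \<ge> int n - 1" by linarith
next
  assume "first = player.Max \<and> odd k \<or> first = player.Mini \<and> even k"
  then show "score n first (matching_property n k) \<le> (2 * k - 1) choose 2"
    by (rule score_le[OF assms])
qed

end
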